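(* Let $k$ be a field and $<$ a monomial preorder on $k[X]=k[x_1,\dots,x_n]$. Let $J\subseteq I$ be ideals of $k[X]_<$ such that $L_<(J)=L_<(I)$. Then $J=I$.
   Context: For $a\in\mathbb{N}^n$ write $x^a=x_1^{\alpha_1}\cdots x_n^{\alpha_n}$. A weak order on a set is a strict partial order for which incomparability is an equivalence relation. A monomial preorder on $k[X]$ is a weak order $<$ on the monomials such that for all $a,b,c\in\mathbb{N}^n$: $x^a<x^b$ if and only if $x^ax^c<x^bx^c$. For $f=\sum c_ax^a\in k[X]$, the leading part $L_<(f)$ is the sum of those terms $c_ax^a$ ($c_a\ne0$) such that no monomial $x^b$ occurring in $f$ satisfies $x^a<x^b$. Put $S_<=\{u\in k[X]\mid L_<(u)=1\}$ (a multiplicative set) and $k[X]_<=S_<^{-1}k[X]$. For $f\in k[X]_<$ choose $u\in S_<$ with $uf\in k[X]$ and set $L_<(f)=L_<(uf)$ (independent of $u$). For a subset $G\subseteq k[X]_<$, the leading ideal $L_<(G)$ is the ideal of $k[X]$ generated by all $L_<(f)$, $f\in G$. *)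

theory Defs
  imports
    "HOL-Library.Poly_Mapping"
    "HOL-Computational_Algebra.Fraction_Field"
    "HOL-Algebra.Subrings"
    "HOL-Algebra.Algebraic_Closure_Type"
begin

text \<open>
  The polynomial ring in the variables \<open>x\<^sub>1, \<dots>, x\<^sub>n\<close> over \<open>'k\<close> is taken inside the polynomial ring in
  countably many variables, as the set of polynomials that involve only the variables with
  index below \<open>n\<close> (indices start at 0). A monomial \<open>x\<^sup>a\<close> is represented by its exponent vector \<open>a\<close>,
  so that multiplication of monomials is addition, and the monomial 1 is \<open>0\<close>.
\<close>

type_synonym mon = "nat \<Rightarrow>\<^sub>0 nat"
type_synonym 'k mpol = "mon \<Rightarrow>\<^sub>0 'k"

definition monomials :: "nat \<Rightarrow> mon set" where
  "monomials n = {a. Poly_Mapping.keys a \<subseteq> {..<n}}"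

definition polys :: "nat \<Rightarrow> 'k::field mpol set" where
  "polys n = {f. Poly_Mapping.keys f \<subseteq> monomials n}"

definition poly_ring :: "nat \<Rightarrow> 'k::field mpol ring" where
  "poly_ring n = ring_of_type_algebra\<lparr>carrier := polys n\<rparr>"

definition weak_order_on :: "'a set \<Rightarrow> ('a \<Rightarrow> 'a \<Rightarrow> bool) \<Rightarrow> bool" where
  "weak_order_on A lt \<longleftrightarrow>
     irreflp_on A lt \<and> transp_on A lt \<and>
     equiv A {(a, b). a \<in> A \<and> b \<in> A \<and> \<not> lt a b \<and> \<not> lt b a}"

definition monomial_preorder :: "nat \<Rightarrow> (mon \<Rightarrow> mon \<Rightarrow> bool) \<Rightarrow> bool" where
  "monomial_preorder n lt \<longleftrightarrow>
     weak_order_on (monomials n) lt \<and>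
     (\<forall>a\<in>monomials n. \<forall>b\<in>monomials n. \<forall>c\<in>monomials n. lt a b \<longleftrightarrow> lt (a + c) (b + c))"

definition lead_part :: "(mon \<Rightarrow> mon \<Rightarrow> bool) \<Rightarrow> 'k::field mpol \<Rightarrow> 'k mpol" where
  "lead_part lt f =
     (\<Sum>a | a \<in> Poly_Mapping.keys f \<and> \<not> (\<exists>b\<in>Poly_Mapping.keys f. lt a b).
        Poly_Mapping.single a (Poly_Mapping.lookup f a))"

definition lead_one :: "nat \<Rightarrow> (mon \<Rightarrow> mon \<Rightarrow> bool) \<Rightarrow> 'k::field mpol set" where
  "lead_one n lt = {u \<in> polys n. lead_part lt u = 1}"

text \<open>
  Since \<open>lead_one n lt\<close> is a multiplicative set in a domain and does not contain 0, the localization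
  is the ring of fractions with denominator in \<open>lead_one n lt\<close> inside the fraction field.
\<close>

definition loc_carrier :: "nat \<Rightarrow> (mon \<Rightarrow> mon \<Rightarrow> bool) \<Rightarrow> 'k::field mpol fract set" where
  "loc_carrier n lt = {Fract f u | f u. f \<in> polys n \<and> u \<in> lead_one n lt}"

definition loc_ring :: "nat \<Rightarrow> (mon \<Rightarrow> mon \<Rightarrow> bool) \<Rightarrow> 'k::field mpol fract ring" where
  "loc_ring n lt = ring_of_type_algebra\<lparr>carrier := loc_carrier n lt\<rparr>"

text \<open>
  The representative \<open>p\<close> is \<open>u x\<close> with \<open>u\<close> in \<open>lead_one n lt\<close>. The choice does not matter for
  elements of the localization, see \<open>loc_lead_part_eq\<close> below.
\<close>

definition loc_lead_part ::
    "nat \<Rightarrow> (mon \<Rightarrow> mon \<Rightarrow> bool) \<Rightarrow> 'k::field mpol fract \<Rightarrow> 'k mpol" where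
  "loc_lead_part n lt x =
     lead_part lt (SOME p. p \<in> polys n \<and> (\<exists>u\<in>lead_one n lt. Fract p 1 = Fract u 1 * x))"

definition leading_ideal ::
    "nat \<Rightarrow> (mon \<Rightarrow> mon \<Rightarrow> bool) \<Rightarrow> 'k::field mpol fract set \<Rightarrow> 'k mpol set" where
  "leading_ideal n lt G = Idl\<^bsub>poly_ring n\<^esub> (loc_lead_part n lt ` G)"


subsection \<open>The definitions are sound\<close>

lemma monomials_0 [simp]: "0 \<in> monomials n"
  by (simp add: monomials_def)

lemma monomials_add: "a \<in> monomials n \<Longrightarrow> b \<in> monomials n \<Longrightarrow> a + b \<in> monomials n"
  unfolding monomials_def using keys_add[of a b] by blast

lemma polys_0 [simp]: "0 \<in> polys n"
  by (simp add: polys_def)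

lemma polys_1 [simp]: "1 \<in> polys n"
  by (simp add: polys_def)

lemma polys_add: "f \<in> polys n \<Longrightarrow> g \<in> polys n \<Longrightarrow> f + g \<in> polys n"
  unfolding polys_def using keys_add[of f g] by blast

lemma polys_uminus: "f \<in> polys n \<Longrightarrow> - f \<in> polys n"
  by (simp add: polys_def in_keys_iff subset_iff)

lemma polys_mult: "f \<in> polys n \<Longrightarrow> g \<in> polys n \<Longrightarrow> f * g \<in> polys n"
  unfolding polys_def using keys_mult[of f g] monomials_add by blast

lemma poly_ring_cring: "cring (poly_ring n :: 'k::field mpol ring)"
proof -
  interpret R: cring "ring_of_type_algebra :: 'k mpol ring" ..
  have neg: "\<ominus>\<^bsub>ring_of_type_algebra\<^esub> x = - x" for x :: "'k mpol"
    by (rule R.minus_equality) (simp_all add: ring_of_type_algebra_def)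
  have "subring (polys n) (ring_of_type_algebra :: 'k mpol ring)"
    by (rule R.subringI)
       (simp_all add: neg polys_uminus, simp_all add: ring_of_type_algebra_def polys_mult polys_add)
  then have "subcring (polys n) (ring_of_type_algebra :: 'k mpol ring)"
    by (rule R.subcringI')
  then show ?thesis
    unfolding poly_ring_def
    by (subst R.subcring_iff[symmetric]) (simp_all add: ring_of_type_algebra_def)
qed

lemma lookup_lead_part:
  "Poly_Mapping.lookup (lead_part lt f) k = (if \<exists>b\<in>Poly_Mapping.keys f. lt k b then 0 else Poly_Mapping.lookup f k)"
proof -
  let ?M = "{a. a \<in> Poly_Mapping.keys f \<and> \<not> (\<exists>b\<in>Poly_Mapping.keys f. lt a b)}"
  have "Poly_Mapping.lookup (lead_part lt f) k = (\<Sum>a\<in>?M. Poly_Mapping.lookup f a when a = k)"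
    by (simp add: lead_part_def lookup_sum lookup_single)
  also have "\<dots> = (\<Sum>a\<in>?M. if k = a then Poly_Mapping.lookup f a else 0)"
    by (rule sum.cong) (auto simp: when_def)
  also have "\<dots> = (if k \<in> ?M then Poly_Mapping.lookup f k else 0)"
    by (subst sum.delta') auto
  finally show ?thesis
    by (auto simp: in_keys_iff)
qed

lemma lead_part_0 [simp]: "lead_part lt 0 = 0"
  by (simp add: lead_part_def)

lemma zero_notin_lead_one: "0 \<notin> lead_one n lt"
  by (simp add: lead_one_def)

context
  fixes n :: nat and lt :: "mon \<Rightarrow> mon \<Rightarrow> bool"
  assumes lt: "monomial_preorder n lt"
begin

lemma lt_irrefl: "a \<in> monomials n \<Longrightarrow> \<not> lt a a"
  using lt by (auto simp: monomial_preorder_def weak_order_on_def irreflp_on_def)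

lemma lt_trans:
  "lt a b \<Longrightarrow> lt b c \<Longrightarrow> a \<in> monomials n \<Longrightarrow> b \<in> monomials n \<Longrightarrow> c \<in> monomials n \<Longrightarrow> lt a c"
  using lt unfolding monomial_preorder_def weak_order_on_def transp_on_def by blast

lemma lt_add:
  "lt a b \<Longrightarrow> a \<in> monomials n \<Longrightarrow> b \<in> monomials n \<Longrightarrow> c \<in> monomials n \<Longrightarrow> lt (a + c) (b + c)"
  using lt unfolding monomial_preorder_def by blast

lemma ex_maximal_above:
  assumes "finite K" "K \<subseteq> monomials n" "a \<in> K"
  shows "\<exists>m\<in>K. (a = m \<or> lt a m) \<and> \<not> (\<exists>b\<in>K. lt m b)"
proof -
  have fin: "finite {b\<in>K. lt x b}" for x
    using assms(1) by simp
  from assms(3) show ?thesis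
  proof (induction "card {b\<in>K. lt a b}" arbitrary: a rule: less_induct)
    case less
    show ?case
    proof (cases "\<exists>b\<in>K. lt a b")
      case True
      then obtain b where b: "b \<in> K" "lt a b" by blast
      have sub: "{c\<in>K. lt b c} \<subseteq> {c\<in>K. lt a c}"
        using b lt_trans less.prems assms(2) by blast
      have "b \<in> {c\<in>K. lt a c}" "b \<notin> {c\<in>K. lt b c}"
        using b lt_irrefl assms(2) by auto
      with sub have "{c\<in>K. lt b c} \<subset> {c\<in>K. lt a c}" by blast
      then have "card {c\<in>K. lt b c} < card {c\<in>K. lt a c}"
        using fin psubset_card_mono by blast
      from less.hyps[OF this b(1)] show ?thesis
        using b lt_trans less.prems assms(2) by blast
    next
      case False
      with less.prems show ?thesis by blast
    qed
  qed
qed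

lemma lead_one_keys:
  assumes "u \<in> lead_one n lt"
  shows "Poly_Mapping.lookup u 0 = 1" "\<And>a. a \<in> Poly_Mapping.keys u \<Longrightarrow> a \<noteq> 0 \<Longrightarrow> lt a 0"
proof -
  have u: "Poly_Mapping.keys u \<subseteq> monomials n" "\<And>k. Poly_Mapping.lookup (lead_part lt u) k = Poly_Mapping.lookup 1 k"
    using assms by (auto simp: lead_one_def polys_def)
  show "Poly_Mapping.lookup u 0 = 1"
    using u(2)[of 0] by (auto simp: lookup_lead_part split: if_splits)
  fix a assume a: "a \<in> Poly_Mapping.keys u" "a \<noteq> 0"
  obtain m where m: "m \<in> Poly_Mapping.keys u" "a = m \<or> lt a m" "\<not> (\<exists>b\<in>Poly_Mapping.keys u. lt m b)"
    using ex_maximal_above[OF finite_keys u(1) a(1)] by blast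
  have "Poly_Mapping.lookup 1 m \<noteq> (0::'a)"
    using m u(2)[of m] by (auto simp: lookup_lead_part in_keys_iff)
  then have "m = 0"
    by (auto simp: lookup_one when_def split: if_splits)
  with m a show "lt a 0" by auto
qed

lemma lead_part_mult:
  assumes u: "u \<in> lead_one n lt" and f: "f \<in> polys n"
  shows "lead_part lt (u * f) = lead_part lt f"
proof -
  define v where "v = u - 1"
  have uf: "u * f = f + v * f"
    by (simp add: v_def algebra_simps)
  have K: "Poly_Mapping.keys u \<subseteq> monomials n" "Poly_Mapping.keys f \<subseteq> monomials n"
    using u f by (auto simp: lead_one_def polys_def)
  have v: "a \<in> monomials n \<and> lt a 0" if "a \<in> Poly_Mapping.keys v" for a
  proof -
    have "a \<noteq> 0"
      using that lead_one_keys(1)[OF u] by (auto simp: v_def in_keys_iff lookup_minus)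
    with that have "a \<in> Poly_Mapping.keys u"
      by (auto simp: v_def in_keys_iff lookup_minus lookup_one)
    with \<open>a \<noteq> 0\<close> show ?thesis
      using lead_one_keys(2)[OF u] K by blast
  qed
  have vf: "k \<in> monomials n \<and> (\<exists>b\<in>Poly_Mapping.keys f. lt k b)" if k: "k \<in> Poly_Mapping.keys (v * f)" for k
  proof -
    obtain a b where ab: "k = a + b" "a \<in> Poly_Mapping.keys v" "b \<in> Poly_Mapping.keys f"
      using k keys_mult[of v f] by blast
    have "lt (a + b) (0 + b)"
      using ab v K by (intro lt_add) auto
    then show ?thesis
      using ab v K monomials_add by auto
  qed
  have K': "Poly_Mapping.keys (u * f) \<subseteq> monomials n"
    using keys_add[of f "v * f"] vf K unfolding uf by blast
  have same: "(\<exists>b\<in>Poly_Mapping.keys (u * f). lt k b) \<longleftrightarrow> (\<exists>b\<in>Poly_Mapping.keys f. lt k b)" if k: "k \<in> monomials n" for k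
  proof
    assume "\<exists>b\<in>Poly_Mapping.keys (u * f). lt k b"
    then obtain b where b: "b \<in> Poly_Mapping.keys (u * f)" "lt k b" by blast
    show "\<exists>b\<in>Poly_Mapping.keys f. lt k b"
    proof (cases "b \<in> Poly_Mapping.keys f")
      case False
      then have "b \<in> Poly_Mapping.keys (v * f)"
        using b keys_add[of f "v * f"] unfolding uf by blast
      then obtain c where "c \<in> Poly_Mapping.keys f" "lt b c"
        using vf by blast
      then show ?thesis
        using lt_trans[OF b(2)] k b K K' by blast
    qed (use b in blast)
  next
    assume "\<exists>b\<in>Poly_Mapping.keys f. lt k b"
    then obtain b where b: "b \<in> Poly_Mapping.keys f" "lt k b" by blast
    obtain m where m: "m \<in> Poly_Mapping.keys f" "b = m \<or> lt b m" "\<not> (\<exists>c\<in>Poly_Mapping.keys f. lt m c)"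
      using ex_maximal_above[OF finite_keys K(2) b(1)] by blast
    have "m \<notin> Poly_Mapping.keys (v * f)" using vf m by blast
    then have "m \<in> Poly_Mapping.keys (u * f)"
      using m by (auto simp: uf in_keys_iff lookup_add)
    moreover have "lt k m"
      using b m k K lt_trans by blast
    ultimately show "\<exists>b\<in>Poly_Mapping.keys (u * f). lt k b" by blast
  qed
  show ?thesis
  proof (rule poly_mapping_eqI)
    fix k
    show "Poly_Mapping.lookup (lead_part lt (u * f)) k = Poly_Mapping.lookup (lead_part lt f) k"
    proof (cases "k \<in> monomials n")
      case True
      show ?thesis
      proof (cases "\<exists>b\<in>Poly_Mapping.keys f. lt k b")
        case False
        then have "k \<notin> Poly_Mapping.keys (v * f)" using vf by blast
        then show ?thesis
          using same[OF True] False by (simp add: lookup_lead_part uf lookup_add in_keys_iff)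
      qed (use same[OF True] in \<open>simp add: lookup_lead_part\<close>)
    next
      case False
      then have "k \<notin> Poly_Mapping.keys f" "k \<notin> Poly_Mapping.keys (u * f)" using K K' by auto
      then show ?thesis
        by (simp add: lookup_lead_part in_keys_iff)
    qed
  qed
qed

lemma lead_one_1: "1 \<in> lead_one n lt"
proof -
  have "lead_part lt 1 = (1 :: 'a mpol)"
    by (rule poly_mapping_eqI) (auto simp: lookup_lead_part lookup_one when_def lt_irrefl)
  then show ?thesis by (simp add: lead_one_def)
qed

lemma lead_one_mult: "u \<in> lead_one n lt \<Longrightarrow> v \<in> lead_one n lt \<Longrightarrow> u * v \<in> lead_one n lt"
  using lead_part_mult[of u v] by (simp add: lead_one_def polys_mult)

lemma loc_ring_cring: "cring (loc_ring n lt :: 'k::field mpol fract ring)"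
proof -
  interpret R: cring "ring_of_type_algebra :: 'k mpol fract ring" ..
  have neg: "\<ominus>\<^bsub>ring_of_type_algebra\<^esub> x = - x" for x :: "'k mpol fract"
    by (rule R.minus_equality) (simp_all add: ring_of_type_algebra_def)
  have 1: "1 \<in> (loc_carrier n lt :: 'k mpol fract set)"
    unfolding loc_carrier_def One_fract_def using lead_one_1 polys_1 by blast
  have 2: "- x \<in> loc_carrier n lt" if "x \<in> loc_carrier n lt" for x :: "'k mpol fract"
    using that polys_uminus by (fastforce simp: loc_carrier_def)
  have 3: "x * y \<in> loc_carrier n lt" if "x \<in> loc_carrier n lt" "y \<in> loc_carrier n lt"
    for x y :: "'k mpol fract"
    using that polys_mult lead_one_mult by (fastforce simp: loc_carrier_def)
  have 4: "x + y \<in> loc_carrier n lt" if xy: "x \<in> loc_carrier n lt" "y \<in> loc_carrier n lt"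
    for x y :: "'k mpol fract"
  proof -
    obtain f u g v where *: "x = Fract f u" "y = Fract g v" "f \<in> polys n" "g \<in> polys n"
      "u \<in> lead_one n lt" "v \<in> lead_one n lt"
      using xy by (auto simp: loc_carrier_def)
    then have "u \<noteq> 0" "v \<noteq> 0" "u \<in> polys n" "v \<in> polys n"
      using zero_notin_lead_one by (auto simp: lead_one_def)
    then have "x + y = Fract (f * v + g * u) (u * v)" "f * v + g * u \<in> polys n"
      using * by (simp_all add: polys_add polys_mult)
    then show ?thesis
      using lead_one_mult * by (auto simp: loc_carrier_def)
  qed
  have "subring (loc_carrier n lt) (ring_of_type_algebra :: 'k mpol fract ring)"
    by (rule R.subringI)
       (simp_all add: neg 2, simp_all add: ring_of_type_algebra_def 1 3 4)
  then have "subcring (loc_carrier n lt) (ring_of_type_algebra :: 'k mpol fract ring)"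
    by (rule R.subcringI')
  then show ?thesis
    unfolding loc_ring_def
    by (subst R.subcring_iff[symmetric]) (simp_all add: ring_of_type_algebra_def)
qed

lemma ex_numerator:
  assumes "x \<in> loc_carrier n lt"
  shows "\<exists>p. p \<in> polys n \<and> (\<exists>u\<in>lead_one n lt. Fract p 1 = Fract u 1 * x)"
proof -
  obtain f u where fu: "x = Fract f u" "f \<in> polys n" "u \<in> lead_one n lt"
    using assms by (auto simp: loc_carrier_def)
  moreover have "u \<noteq> 0"
    using fu zero_notin_lead_one by blast
  ultimately have "Fract f 1 = Fract u 1 * x"
    by (simp add: eq_fract mult.commute)
  with fu show ?thesis by blast
qed

lemma loc_lead_part_eq:
  assumes "p \<in> polys n" "u \<in> lead_one n lt" "Fract p 1 = Fract u 1 * x"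
  shows "loc_lead_part n lt x = lead_part lt p"
proof -
  let ?P = "\<lambda>p. p \<in> polys n \<and> (\<exists>u\<in>lead_one n lt. Fract p 1 = Fract u 1 * x)"
  define q where "q = (SOME p. ?P p)"
  have "?P q"
    unfolding q_def using assms by (intro someI[of ?P p]) blast
  then obtain v where q: "q \<in> polys n" "v \<in> lead_one n lt" "Fract q 1 = Fract v 1 * x"
    by blast
  have "Fract (v * p) 1 = Fract v 1 * (Fract u 1 * x)"
    by (simp add: assms(3)[symmetric])
  also have "\<dots> = Fract u 1 * Fract q 1"
    by (simp only: q(3) mult.left_commute)
  finally have "v * p = u * q"
    by (simp add: eq_fract)
  then have "lead_part lt p = lead_part lt q"
    using lead_part_mult[OF q(2) assms(1)] lead_part_mult[OF assms(2) q(1)] by simp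
  then show ?thesis
    by (simp add: loc_lead_part_def q_def)
qed

end

end

theory Submission
  imports Defs
begin

text \<open>
  Breaking ties by the lexicographic order refines \<open><\<close> to a total monomial order \<open><\<^sup>*\<close>. As 1 is the
  lexicographically least monomial, \<open>a <\<^sup>* 1\<close> still implies \<open>a < 1\<close>, so the set \<open>S\<^sub><\<close> does not grow.
  Comparing homogeneous components with respect to incomparability, \<open>L(I) = L(J)\<close> yields
  for each \<open>h\<close> in \<open>I\<close> some \<open>g\<close> in \<open>J\<close> with the same \<open><\<^sup>*\<close>-leading monomial.

  Given a polynomial \<open>f\<close> in \<open>I\<close>, let \<open>H\<close> consist of the \<open>u f - j\<close> with \<open>u\<close> in \<open>S\<^sub><\<close> and \<open>j\<close> in \<open>J\<close>; we need
  \<open>0 \<in> H\<close>. Otherwise we argue as for Mora's division algorithm. The order \<open><\<^sup>*\<close> is not well-founded, but by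
  Dickson's lemma finitely many elements of \<open>J \<union> H\<close> suffice to reduce every \<open>h \<in> H\<close> without
  raising its total degree. If the leading monomial of \<open>h\<close> is below those of the finitely many
  reducers from \<open>H\<close>, the reductions stay in \<open>H\<close>. This gives infinitely many leading
  monomials of bounded degree, which is absurd.
\<close>

section \<open>Monotone subsequences and Dickson's lemma\<close>

lemma nat_mono_subseq:
  fixes s :: "nat \<Rightarrow> nat"
  obtains r :: "nat \<Rightarrow> nat" where "strict_mono r" "mono (\<lambda>k. s (r k))"
proof -
  obtain r :: "nat \<Rightarrow> nat" where r: "strict_mono r" "monoseq (\<lambda>k. s (r k))"
    using seq_monosub by blast
  show thesis
  proof (cases "mono (\<lambda>k. s (r k))")
    case False
    with r(2) have dec: "decseq (\<lambda>k. s (r k))"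
      by (auto simp: monoseq_iff)
    \<comment> \<open>A non-increasing sequence of naturals is constant from any index where it
      attains its minimum, so a tail of it is also non-decreasing.\<close>
    obtain N where N: "\<And>k. s (r N) \<le> s (r k)"
      using ex_has_least_nat[of "\<lambda>_. True" 0 "\<lambda>k. s (r k)"] by auto
    have "s (r (N + k)) = s (r N)" for k
      using N[of "N + k"] dec by (auto simp: decseq_def intro: antisym)
    then have "mono (\<lambda>k. s (r (N + k)))"
      by (simp add: mono_def)
    moreover have "strict_mono (\<lambda>k. r (N + k))"
      using r(1) by (simp add: strict_mono_def)
    ultimately show thesis
      by (intro that[of "\<lambda>k. r (N + k)"])
  qed (use r that in blast)
qed

lemma dickson_subseq:
  fixes v :: "nat \<Rightarrow> 'i \<Rightarrow> nat"
  assumes "finite S"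
  shows "\<exists>r :: nat \<Rightarrow> nat. strict_mono r \<and> (\<forall>i\<in>S. mono (\<lambda>k. v (r k) i))"
  using assms
proof (induction S)
  case empty
  then show ?case
    by (intro exI[of _ id]) (simp add: strict_mono_def)
next
  case (insert x S)
  then obtain r :: "nat \<Rightarrow> nat" where r: "strict_mono r" "\<And>i. i \<in> S \<Longrightarrow> mono (\<lambda>k. v (r k) i)"
    by blast
  obtain q :: "nat \<Rightarrow> nat" where q: "strict_mono q" "mono (\<lambda>k. v (r (q k)) x)"
    using nat_mono_subseq[of "\<lambda>k. v (r k) x"] by blast
  have "mono (\<lambda>k. v (r (q k)) i)" if "i \<in> S" for i
    using r(2)[OF that] strict_mono_leD[OF q(1)] by (simp add: mono_def)
  with q r(1) show ?case
    using strict_mono_o[of r q] by (intro exI[of _ "r \<circ> q"]) (auto simp: o_def)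
qed

text \<open>If no finite \<open>B\<close> worked, one could choose step by step an infinite sequence
  in which no earlier vector lies below a later one, against \<open>dickson_subseq\<close>. The map
  \<open>v\<close> is arbitrary because the lemma is applied to pairs of a monomial and a number,
  the number serving as one more coordinate.\<close>

lemma dickson:
  fixes v :: "'a \<Rightarrow> 'i \<Rightarrow> nat"
  assumes "finite S"
  obtains B where "B \<subseteq> A" "finite B" "\<And>x. x \<in> A \<Longrightarrow> \<exists>y\<in>B. \<forall>i\<in>S. v y i \<le> v x i"
proof -
  have "\<exists>B\<subseteq>A. finite B \<and> (\<forall>x\<in>A. \<exists>y\<in>B. \<forall>i\<in>S. v y i \<le> v x i)"
  proof (rule ccontr)
    assume none: "\<not> ?thesis"
    define P where "P f k x \<longleftrightarrow> x \<in> A \<and> (\<forall>j<k. \<not> (\<forall>i\<in>S. v (f j) i \<le> v x i))"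
      for f :: "nat \<Rightarrow> 'a" and k x
    have "\<exists>f. \<forall>k. P f k (f k)"
    proof (rule dependent_wellorder_choice)
      fix r and f g :: "nat \<Rightarrow> 'a" and k
      assume "\<And>j. j < k \<Longrightarrow> f j = g j"
      then show "P f k r = P g k r"
        by (auto simp: P_def)
    next
      fix k f
      assume "\<And>j. j < k \<Longrightarrow> P f j (f j)"
      then have "f ` {..<k} \<subseteq> A" "finite (f ` {..<k})"
        by (auto simp: P_def)
      then obtain x where "x \<in> A" "\<not> (\<exists>y\<in>f ` {..<k}. \<forall>i\<in>S. v y i \<le> v x i)"
        using none by blast
      then show "\<exists>x. P f k x"
        unfolding P_def by blast
    qed
    then obtain f where f: "\<And>k. P f k (f k)" by blast
    obtain r :: "nat \<Rightarrow> nat" where r: "strict_mono r" "\<And>i. i \<in> S \<Longrightarrow> mono (\<lambda>k. v (f (r k)) i)"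
      using dickson_subseq[OF assms, of "\<lambda>k. v (f k)"] by blast
    have "r 0 < r 1"
      using r(1) by (simp add: strict_mono_def)
    moreover have "\<forall>i\<in>S. v (f (r 0)) i \<le> v (f (r 1)) i"
      using r(2) by (auto simp: mono_def)
    ultimately show False
      using f[of "r 1"] by (auto simp: P_def)
  qed
  with that show thesis by blast
qed

section \<open>Total degree and divisibility of monomials\<close>

definition mdeg :: "nat \<Rightarrow> mon \<Rightarrow> nat" where
  "mdeg n a = (\<Sum>i<n. Poly_Mapping.lookup a i)"

lemma mdeg_add: "mdeg n (a + b) = mdeg n a + mdeg n b"
  by (simp add: mdeg_def lookup_add sum.distrib)

lemma finite_bounded_mdeg: "finite {a \<in> monomials n. mdeg n a \<le> D}"
proof -
  let ?F = "{f :: nat \<Rightarrow> nat. \<forall>i. (i \<in> {..<n} \<longrightarrow> f i \<in> {..D}) \<and> (i \<notin> {..<n} \<longrightarrow> f i = 0)}"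
  have "Poly_Mapping.lookup ` {a \<in> monomials n. mdeg n a \<le> D} \<subseteq> ?F"
  proof (rule image_subsetI)
    fix a assume a: "a \<in> {a \<in> monomials n. mdeg n a \<le> D}"
    have "Poly_Mapping.lookup a i \<le> D" if "i < n" for i
      using member_le_sum[of i "{..<n}" "Poly_Mapping.lookup a"] that a
      by (simp add: mdeg_def)
    with a show "Poly_Mapping.lookup a \<in> ?F"
      by (auto simp: monomials_def in_keys_iff)
  qed
  moreover have "finite ?F"
    by (rule finite_set_of_finite_funs) auto
  moreover have "inj_on Poly_Mapping.lookup {a \<in> monomials n. mdeg n a \<le> D}"
    using poly_mapping_eq_iff by (auto intro!: inj_onI)
  ultimately show ?thesis
    using finite_imageD finite_subset by blast
qed

lemma mon_dvdI:
  assumes "a \<in> monomials n" "b \<in> monomials n"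
    and "\<And>i. i < n \<Longrightarrow> Poly_Mapping.lookup b i \<le> Poly_Mapping.lookup a i"
  shows "\<exists>c\<in>monomials n. a = c + b"
proof
  have le: "Poly_Mapping.lookup b i \<le> Poly_Mapping.lookup a i" for i
  proof (cases "i < n")
    case False
    then have "i \<notin> Poly_Mapping.keys b"
      using assms(2) by (auto simp: monomials_def)
    then show ?thesis by (simp add: in_keys_iff)
  qed (use assms(3) in simp)
  show "a = (a - b) + b"
    using le by (intro poly_mapping_eqI) (simp add: lookup_add minus_poly_mapping.rep_eq)
  show "a - b \<in> monomials n"
    using assms(1) by (auto simp: monomials_def in_keys_iff minus_poly_mapping.rep_eq subset_iff)
qed

text \<open>Here \<open><\<close> is the lexicographic order of exponent vectors, decided at the
  smallest index where they differ; there \<open>a\<close> would need an exponent below 0.\<close>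

lemma mon_not_less_0: "\<not> (a :: mon) < 0"
  by transfer (auto simp: less_fun_def)

section \<open>Multiplication by terms, and ideals of the polynomial ring\<close>

lemma lookup_single_mult:
  fixes p :: "'k::field mpol"
  shows "Poly_Mapping.lookup (Poly_Mapping.single b c * p) (b + d) = c * Poly_Mapping.lookup p d"
  by (simp add: lookup_mult lookup_single when_mult)

lemma keys_single_mult:
  fixes p :: "'k::field mpol"
  assumes "a \<in> Poly_Mapping.keys (Poly_Mapping.single b c * p)"
  obtains d where "a = b + d" "d \<in> Poly_Mapping.keys p"
  using assms keys_mult[of "Poly_Mapping.single b c" p] by (auto split: if_splits)

lemma single_in_polys: "b \<in> monomials n \<Longrightarrow> Poly_Mapping.single b c \<in> polys n"
  by (simp add: polys_def)

lemma polys_diff: "f \<in> polys n \<Longrightarrow> g \<in> polys n \<Longrightarrow> f - g \<in> polys n"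
  using polys_add[of f n "- g"] polys_uminus[of g n] by simp

lemma poly_mapping_sum_single:
  "p = (\<Sum>a\<in>Poly_Mapping.keys p. Poly_Mapping.single a (Poly_Mapping.lookup p a))"
proof (rule poly_mapping_eqI)
  fix k
  have "(\<Sum>a\<in>Poly_Mapping.keys p. Poly_Mapping.lookup p a when a = k) =
      (\<Sum>a\<in>Poly_Mapping.keys p. if k = a then Poly_Mapping.lookup p a else 0)"
    by (rule sum.cong) (auto simp: when_def)
  also have "\<dots> = Poly_Mapping.lookup p k"
    by (subst sum.delta') (auto simp: in_keys_iff)
  finally show "Poly_Mapping.lookup p k = Poly_Mapping.lookup
      (\<Sum>a\<in>Poly_Mapping.keys p. Poly_Mapping.single a (Poly_Mapping.lookup p a)) k"
    by (simp add: lookup_sum lookup_single)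
qed

lemma lead_part_in_polys: "f \<in> polys n \<Longrightarrow> lead_part lt f \<in> polys n"
  by (auto simp: polys_def in_keys_iff lookup_lead_part subset_iff split: if_splits)

lemma poly_ring_simps [simp]:
  "carrier (poly_ring n) = polys n" "monoid.mult (poly_ring n) = (*)" "ring.add (poly_ring n) = (+)"
  "ring.zero (poly_ring n) = 0" "monoid.one (poly_ring n) = 1"
  by (simp_all add: poly_ring_def ring_of_type_algebra_def)

lemma loc_ring_simps [simp]:
  "carrier (loc_ring n lt) = loc_carrier n lt" "monoid.mult (loc_ring n lt) = (*)"
  "ring.add (loc_ring n lt) = (+)" "ring.zero (loc_ring n lt) = 0" "monoid.one (loc_ring n lt) = 1"
  by (simp_all add: loc_ring_def ring_of_type_algebra_def)

text \<open>Since \<open>- p\<close> is \<open>- 1 * p\<close>, these closure conditions already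
  make \<open>P\<close> an additive subgroup.\<close>

lemma ideal_poly_ring_iff:
  fixes P :: "'k::field mpol set"
  shows "ideal P (poly_ring n) \<longleftrightarrow> P \<subseteq> polys n \<and> 0 \<in> P \<and> (\<forall>p\<in>P. \<forall>q\<in>P. p + q \<in> P) \<and>
    (\<forall>r\<in>polys n. \<forall>p\<in>P. r * p \<in> P)" (is "_ \<longleftrightarrow> ?R")
proof
  assume P: "ideal P (poly_ring n)"
  note add = ideal.axioms(1)[OF P]
  show ?R
    using additive_subgroup.a_subset[OF add] additive_subgroup.zero_closed[OF add]
      additive_subgroup.a_closed[OF add] ideal.I_l_closed[OF P] by auto
next
  assume P: ?R
  interpret R: cring "poly_ring n :: 'k mpol ring"
    by (rule poly_ring_cring)
  have neg: "\<ominus>\<^bsub>poly_ring n\<^esub> p = - p" if "p \<in> polys n" for p :: "'k mpol"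
    using that polys_uminus by (intro R.minus_equality) auto
  have um: "- p \<in> P" if "p \<in> P" for p
    using P that polys_uminus[OF polys_1, of n] by (metis mult_minus1)
  have "p * r \<in> P" if "p \<in> P" "r \<in> polys n" for p r
    using P that by (metis mult.commute)
  then show "ideal P (poly_ring n)"
  proof (intro idealI)
    show "subgroup P (add_monoid (poly_ring n))"
      using P um neg by (intro R.add.subgroupI) (auto simp: a_inv_def)
  qed (use P R.ring_axioms in auto)
qed

lemma ideal_poly_ringD:
  fixes P :: "'k::field mpol set"
  assumes "ideal P (poly_ring n)"
  shows "p \<in> P \<Longrightarrow> p \<in> polys n" "0 \<in> P" "p \<in> P \<Longrightarrow> q \<in> P \<Longrightarrow> p + q \<in> P"
    "r \<in> polys n \<Longrightarrow> p \<in> P \<Longrightarrow> r * p \<in> P" "p \<in> P \<Longrightarrow> q \<in> P \<Longrightarrow> p - q \<in> P"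
proof -
  have P: "P \<subseteq> polys n \<and> 0 \<in> P \<and> (\<forall>p\<in>P. \<forall>q\<in>P. p + q \<in> P) \<and>
    (\<forall>r\<in>polys n. \<forall>p\<in>P. r * p \<in> P)"
    by (rule iffD1[OF ideal_poly_ring_iff assms])
  then show "p \<in> P \<Longrightarrow> p \<in> polys n" "0 \<in> P" "p \<in> P \<Longrightarrow> q \<in> P \<Longrightarrow> p + q \<in> P"
    "r \<in> polys n \<Longrightarrow> p \<in> P \<Longrightarrow> r * p \<in> P"
    by blast+
  show "p - q \<in> P" if "p \<in> P" "q \<in> P"
  proof -
    have "- 1 * q \<in> P"
      using P that polys_uminus[OF polys_1] by blast
    with P that have "p + - 1 * q \<in> P" by blast
    then show ?thesis by simp
  qed
qed

text \<open>This is the contraction of \<open>Y\<close> to the polynomial ring; it reduces the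
  theorem to ideals of polynomials.\<close>

definition numerators :: "nat \<Rightarrow> 'k::field mpol fract set \<Rightarrow> 'k mpol set" where
  "numerators n Y = {p \<in> polys n. Fract p 1 \<in> Y}"

definition tie_break :: "(mon \<Rightarrow> mon \<Rightarrow> bool) \<Rightarrow> mon \<Rightarrow> mon \<Rightarrow> bool" where
  "tie_break lt a b \<longleftrightarrow> lt a b \<or> \<not> lt b a \<and> a < b"

text \<open>A relation rather than a function, so that the zero polynomial simply has no leading
  monomial.\<close>

definition leading_mon :: "(mon \<Rightarrow> mon \<Rightarrow> bool) \<Rightarrow> 'k::field mpol \<Rightarrow> mon \<Rightarrow> bool" where
  "leading_mon lt f m \<longleftrightarrow>
     m \<in> Poly_Mapping.keys f \<and> (\<forall>b\<in>Poly_Mapping.keys f. b \<noteq> m \<longrightarrow> tie_break lt b m)"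

section \<open>The refined order is a total order compatible with multiplication\<close>

context
  fixes n :: nat and lt :: "mon \<Rightarrow> mon \<Rightarrow> bool"
  assumes lt: "monomial_preorder n lt"
begin

lemma lt_add_iff:
  "a \<in> monomials n \<Longrightarrow> b \<in> monomials n \<Longrightarrow> c \<in> monomials n \<Longrightarrow> lt (a + c) (b + c) \<longleftrightarrow> lt a b"
  using lt unfolding monomial_preorder_def by blast

lemma incomparable_trans:
  assumes "a \<in> monomials n" "b \<in> monomials n" "c \<in> monomials n"
    and "\<not> lt a b" "\<not> lt b a" "\<not> lt b c" "\<not> lt c b"
  shows "\<not> lt a c"
proof -
  have "trans {(a, b). a \<in> monomials n \<and> b \<in> monomials n \<and> \<not> lt a b \<and> \<not> lt b a}"
    using lt by (auto simp: monomial_preorder_def weak_order_on_def equiv_def)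
  with assms show ?thesis
    unfolding trans_def by blast
qed

text \<open>The order descends to incomparability classes: otherwise \<open>a\<close> and
  \<open>c\<close> would be incomparable, and by transitivity so would \<open>b\<close> and
  \<open>c\<close>.\<close>

lemma incomparable_left:
  assumes "a \<in> monomials n" "b \<in> monomials n" "c \<in> monomials n"
    and "\<not> lt a b" "\<not> lt b a" "lt b c"
  shows "lt a c"
proof (rule ccontr)
  assume "\<not> lt a c"
  moreover have "\<not> lt c a"
    using assms lt_trans[OF lt, of b c a] by blast
  ultimately show False
    using incomparable_trans[of b a c] assms by blast
qed

lemma incomparable_right:
  assumes "a \<in> monomials n" "b \<in> monomials n" "c \<in> monomials n"
    and "\<not> lt a b" "\<not> lt b a" "lt c b"
  shows "lt c a"
proof (rule ccontr)
  assume "\<not> lt c a"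
  moreover have "\<not> lt a c"
    using assms lt_trans[OF lt, of a c b] by blast
  ultimately show False
    using incomparable_trans[of c a b] assms by blast
qed

lemma tie_break_total: "a \<noteq> b \<Longrightarrow> tie_break lt a b \<or> tie_break lt b a"
  by (auto simp: tie_break_def)

lemma tie_break_irrefl: "a \<in> monomials n \<Longrightarrow> \<not> tie_break lt a a"
  using lt_irrefl[OF lt] by (auto simp: tie_break_def)

lemma tie_break_trans:
  assumes "a \<in> monomials n" "b \<in> monomials n" "c \<in> monomials n"
    and "tie_break lt a b" "tie_break lt b c"
  shows "tie_break lt a c"
proof -
  consider "lt a b" "lt b c" | "lt a b" "\<not> lt b c" "\<not> lt c b"
    | "\<not> lt a b" "\<not> lt b a" "lt b c" | "\<not> lt a b" "\<not> lt b a" "\<not> lt b c" "\<not> lt c b" "a < b" "b < c"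
    using assms by (auto simp: tie_break_def)
  then show ?thesis
  proof cases
    case 4
    then show ?thesis
      using incomparable_trans[of c b a] assms by (auto simp: tie_break_def)
  qed (use assms lt_trans[OF lt] incomparable_left incomparable_right in
       \<open>unfold tie_break_def, blast+\<close>)
qed

lemma tie_break_add_iff:
  "a \<in> monomials n \<Longrightarrow> b \<in> monomials n \<Longrightarrow> c \<in> monomials n \<Longrightarrow>
    tie_break lt (a + c) (b + c) \<longleftrightarrow> tie_break lt a b"
  by (simp add: tie_break_def lt_add_iff)

lemma tie_break_0: "tie_break lt a 0 \<Longrightarrow> lt a 0"
  using mon_not_less_0 by (auto simp: tie_break_def)

lemma ex_tie_break_min:
  assumes "finite M" "M \<noteq> {}" "M \<subseteq> monomials n"
  obtains m where "m \<in> M" "\<And>x. x \<in> M \<Longrightarrow> x = m \<or> tie_break lt m x"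
proof -
  have "transp_on M (tie_break lt)"
    using tie_break_trans assms(3) unfolding transp_on_def by blast
  moreover from this have "asymp_on M (tie_break lt)"
    using tie_break_irrefl assms(3) unfolding transp_on_def asymp_on_def by blast
  ultimately show thesis
    using Finite_Set.bex_min_element[of M "tie_break lt"] assms that tie_break_total by metis
qed

lemma ex_leading_mon:
  assumes "f \<in> polys n" "f \<noteq> 0"
  obtains m where "leading_mon lt f m"
proof -
  let ?M = "Poly_Mapping.keys f"
  have M: "finite ?M" "?M \<noteq> {}" "?M \<subseteq> monomials n"
    using assms by (auto simp: polys_def)
  have "transp_on ?M (tie_break lt)"
    using tie_break_trans M(3) unfolding transp_on_def by blast
  moreover from this have "asymp_on ?M (tie_break lt)"
    using tie_break_irrefl M(3) unfolding transp_on_def asymp_on_def by blast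
  ultimately obtain m where "m \<in> ?M" "\<forall>x\<in>?M. x \<noteq> m \<longrightarrow> \<not> tie_break lt m x"
    using Finite_Set.bex_max_element[of ?M "tie_break lt"] M by blast
  then show thesis
    using that tie_break_total unfolding leading_mon_def by metis
qed

section \<open>Polynomials with leading part 1\<close>

lemma lead_oneI:
  fixes u :: "'k::field mpol"
  assumes "u \<in> polys n" "Poly_Mapping.lookup u 0 = 1"
    and "\<And>a. a \<in> Poly_Mapping.keys u \<Longrightarrow> a \<noteq> 0 \<Longrightarrow> lt a 0"
  shows "u \<in> lead_one n lt"
proof -
  have 0: "0 \<in> Poly_Mapping.keys u"
    using assms(2) by (simp add: in_keys_iff)
  have "\<not> lt 0 b" if "b \<in> Poly_Mapping.keys u" for b
    using that assms(1,3) lt_irrefl[OF lt, of 0] lt_trans[OF lt, of 0 b 0]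
    by (cases "b = 0") (auto simp: polys_def)
  moreover have "Poly_Mapping.lookup u k = 0" if "k \<noteq> 0" "\<not> lt k 0" for k
    using assms(3) that by (auto simp: in_keys_iff)
  ultimately have "lead_part lt u = 1"
    using 0 assms(2) by (intro poly_mapping_eqI) (auto simp: lookup_lead_part lookup_one when_def)
  with assms(1) show ?thesis
    by (simp add: lead_one_def)
qed

text \<open>As \<open>a\<close> is below 1 and no monomial of \<open>v\<close> exceeds 1, the
  product has only monomials below 1, so subtracting it leaves the leading part 1 intact. This
  allows one element of \<open>H\<close> to be reduced by another.\<close>

lemma lead_one_perturb:
  fixes u v :: "'k::field mpol"
  assumes "u \<in> lead_one n lt" "v \<in> lead_one n lt" "a \<in> monomials n" "lt a 0"
  shows "u - Poly_Mapping.single a c * v \<in> lead_one n lt"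
proof -
  have uv: "u \<in> polys n" "v \<in> polys n"
    using assms by (auto simp: lead_one_def)
  have keys: "lt d 0" if d: "d \<in> Poly_Mapping.keys (Poly_Mapping.single a c * v)" for d
  proof -
    obtain b where b: "d = a + b" "b \<in> Poly_Mapping.keys v"
      using d by (rule keys_single_mult)
    then have mon: "b \<in> monomials n"
      using uv by (auto simp: polys_def)
    then have "lt (a + b) b"
      using lt_add[OF lt assms(4,3), of b] by simp
    with b mon assms(3) show ?thesis
      using lead_one_keys(2)[OF lt assms(2) b(2)] lt_trans[OF lt, of "a + b" b 0] monomials_add
      by (cases "b = 0") auto
  qed
  show ?thesis
  proof (rule lead_oneI)
    show "u - Poly_Mapping.single a c * v \<in> polys n"
      using uv assms(3) by (intro polys_diff polys_mult single_in_polys)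
    have "0 \<notin> Poly_Mapping.keys (Poly_Mapping.single a c * v)"
      using keys lt_irrefl[OF lt, of 0] by auto
    then show "Poly_Mapping.lookup (u - Poly_Mapping.single a c * v) 0 = 1"
      using lead_one_keys(1)[OF lt assms(1)] by (simp add: lookup_minus in_keys_iff)
    show "lt d 0" if "d \<in> Poly_Mapping.keys (u - Poly_Mapping.single a c * v)" "d \<noteq> 0" for d
      using that keys[of d] lead_one_keys(2)[OF lt assms(1), of d]
      by (cases "d \<in> Poly_Mapping.keys u") (auto simp: lookup_minus in_keys_iff)
  qed
qed

section \<open>Comparing an ideal with its leading ideal, one incomparability class at a
  time\<close>

lemma leading_ideal_components:
  fixes J :: "'k::field mpol set"
  assumes J: "ideal J (poly_ring n)"
    and p: "p \<in> Idl\<^bsub>poly_ring n\<^esub> (lead_part lt ` J)" and a: "a \<in> monomials n"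
  shows "\<exists>g\<in>J. (\<forall>b\<in>Poly_Mapping.keys g. \<not> lt a b) \<and>
    (\<forall>b\<in>monomials n. \<not> lt a b \<and> \<not> lt b a \<longrightarrow> Poly_Mapping.lookup g b = Poly_Mapping.lookup p b)"
proof -
  note JD = ideal_poly_ringD[OF J]
  \<comment> \<open>\<open>C a p g\<close>: the component of \<open>p\<close> at the incomparability class of \<open>a\<close> is that of \<open>g \<in> J\<close>, and \<open>g\<close> has
    no greater monomials. Unlike being a leading part, this is preserved by sums even when the
    components cancel.\<close>
  define C where "C a p g \<longleftrightarrow> g \<in> J \<and> (\<forall>b\<in>Poly_Mapping.keys g. \<not> lt a b) \<and>
    (\<forall>b\<in>monomials n. \<not> lt a b \<and> \<not> lt b a \<longrightarrow> Poly_Mapping.lookup g b = Poly_Mapping.lookup p b)"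
    for a and p g :: "'k mpol"
  \<comment> \<open>\<open>Q\<close> turns out to be an ideal containing all leading parts of
    \<open>J\<close>, hence the ideal they generate.\<close>
  define Q where "Q = {p \<in> polys n. \<forall>a\<in>monomials n. \<exists>g. C a p g}"
  have Q0: "0 \<in> Q"
    using JD(2) by (auto simp: Q_def C_def intro!: exI[of _ 0])
  have Cadd: "C a (p + q) (g + h)" if "C a p g" "C a q h" for a p q g h
    using that JD(3) keys_add[of g h] by (auto simp: C_def lookup_add)
  have Qadd: "p + q \<in> Q" if "p \<in> Q" "q \<in> Q" for p q
    using that Cadd polys_add unfolding Q_def by blast
  have Qsingle: "Poly_Mapping.single b c * p \<in> Q" if p: "p \<in> Q" and b: "b \<in> monomials n" for b c p
  proof -
    let ?s = "Poly_Mapping.single b c"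
    have pp: "p \<in> polys n" using p by (simp add: Q_def)
    have "\<exists>g. C a (?s * p) g" if a: "a \<in> monomials n" for a
    \<comment> \<open>If the class of \<open>a\<close> contains some \<open>b + e\<close>, the
      component of \<open>?s * p\<close> there comes from that of \<open>p\<close> at
      \<open>e\<close>, and \<open>?s\<close> times the witness for \<open>e\<close> works.
      Otherwise the component is 0, and 0 is a witness.\<close>
    proof (cases "\<exists>e\<in>monomials n. \<not> lt a (b + e) \<and> \<not> lt (b + e) a")
      case True
      then obtain e where e: "e \<in> monomials n" "\<not> lt a (b + e)" "\<not> lt (b + e) a" by blast
      have be: "b + e \<in> monomials n" using b e monomials_add by blast
      obtain g where g: "g \<in> J" "\<And>d. d \<in> Poly_Mapping.keys g \<Longrightarrow> \<not> lt e d"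
        "\<And>d. d \<in> monomials n \<Longrightarrow> \<not> lt e d \<Longrightarrow> \<not> lt d e \<Longrightarrow> Poly_Mapping.lookup g d = Poly_Mapping.lookup p d"
        using p e(1) unfolding Q_def C_def by blast
      have gp: "Poly_Mapping.keys g \<subseteq> monomials n"
        using JD(1)[OF g(1)] by (simp add: polys_def)
      have "\<not> lt a d" if d: "d \<in> Poly_Mapping.keys (?s * g)" for d
      proof
        assume ad: "lt a d"
        obtain x where x: "d = b + x" "x \<in> Poly_Mapping.keys g"
          using d by (rule keys_single_mult)
        then have xm: "x \<in> monomials n" using gp by blast
        have "lt (b + e) (b + x)"
          using incomparable_left[OF be a _ e(3,2)] ad x xm b monomials_add by blast
        then have "lt e x"
          using lt_add_iff[OF e(1) xm b] by (simp add: add.commute)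
        then show False using g(2) x by blast
      qed
      moreover have "Poly_Mapping.lookup (?s * g) d = Poly_Mapping.lookup (?s * p) d"
        if d: "d \<in> monomials n" "\<not> lt a d" "\<not> lt d a" for d
      proof (cases "\<exists>x\<in>monomials n. d = b + x")
        case True
        then obtain x where x: "x \<in> monomials n" "d = b + x" by blast
        have "\<not> lt (b + e) (b + x)" "\<not> lt (b + x) (b + e)"
          using incomparable_trans[OF be a d(1)] incomparable_trans[OF d(1) a be] e d x by blast+
        then have "\<not> lt e x" "\<not> lt x e"
          using lt_add_iff[OF e(1) x(1) b] lt_add_iff[OF x(1) e(1) b] by (simp_all add: add.commute)
        then show ?thesis
          using g(3) x by (simp add: lookup_single_mult)
      next
        case False
        then have "d \<notin> Poly_Mapping.keys (?s * g)" "d \<notin> Poly_Mapping.keys (?s * p)"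
          using gp pp by (auto simp: polys_def elim!: keys_single_mult)
        then show ?thesis by (simp add: in_keys_iff)
      qed
      moreover have "?s * g \<in> J"
        using JD(4) g(1) b single_in_polys by blast
      ultimately show ?thesis unfolding C_def by blast
    next
      case False
      have "Poly_Mapping.lookup (?s * p) d = 0" if d: "d \<in> monomials n" "\<not> lt a d" "\<not> lt d a" for d
      proof (rule ccontr)
        assume "\<not> ?thesis"
        then have "d \<in> Poly_Mapping.keys (?s * p)" by (simp add: in_keys_iff)
        then obtain x where "d = b + x" "x \<in> Poly_Mapping.keys p" by (rule keys_single_mult)
        with d False pp show False by (auto simp: polys_def)
      qed
      then show ?thesis
        using JD(2) by (auto simp: C_def intro!: exI[of _ 0])
    qed
    then show ?thesis
      using pp b by (simp add: Q_def polys_mult single_in_polys)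
  qed
  have Qmult: "r * p \<in> Q" if "r \<in> polys n" "p \<in> Q" for r p
  proof -
    have sum: "sum g A \<in> Q" if "\<And>x. x \<in> A \<Longrightarrow> g x \<in> Q" for g :: "mon \<Rightarrow> 'k mpol" and A
      using that by (induction A rule: infinite_finite_induct) (auto intro: Q0 Qadd)
    have "r * p = (\<Sum>a\<in>Poly_Mapping.keys r. Poly_Mapping.single a (Poly_Mapping.lookup r a) * p)"
      by (subst poly_mapping_sum_single[of r]) (simp only: sum_distrib_right)
    also have "\<dots> \<in> Q"
      using that by (intro sum Qsingle) (auto simp: polys_def)
    finally show ?thesis .
  qed
  have "ideal Q (poly_ring n)"
    unfolding ideal_poly_ring_iff using Q0 Qadd Qmult by (auto simp: Q_def)
  moreover have "lead_part lt ` J \<subseteq> Q"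
  proof
    fix q assume "q \<in> lead_part lt ` J"
    then obtain f where f: "f \<in> J" "q = lead_part lt f" by blast
    have fp: "Poly_Mapping.keys f \<subseteq> monomials n"
      using JD(1)[OF f(1)] by (simp add: polys_def)
    have "\<exists>g. C a q g" if a: "a \<in> monomials n" for a
    \<comment> \<open>If a maximal monomial of \<open>f\<close> lies in the class of
      \<open>a\<close>, then every monomial of \<open>f\<close> in this class is maximal, so
      \<open>f\<close> itself is a witness. Otherwise the leading part vanishes on the class, and 0
      is a witness.\<close>
    proof (cases "\<exists>b\<in>Poly_Mapping.keys f. \<not> lt a b \<and> \<not> lt b a \<and> \<not> (\<exists>c\<in>Poly_Mapping.keys f. lt b c)")
      case True
      then obtain b where b: "b \<in> Poly_Mapping.keys f" "\<not> lt a b" "\<not> lt b a"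
        "\<And>c. c \<in> Poly_Mapping.keys f \<Longrightarrow> \<not> lt b c" by blast
      have max: "\<not> lt a c" if "c \<in> Poly_Mapping.keys f" for c
        using incomparable_left[of b a c] b that a fp by blast
      have "\<not> lt d c" if "d \<in> monomials n" "\<not> lt a d" "\<not> lt d a" "c \<in> Poly_Mapping.keys f" for c d
        using incomparable_left[of a d c] max that a fp by blast
      with f max show ?thesis
        by (auto simp: C_def lookup_lead_part intro!: exI[of _ f])
    next
      case False
      then have "Poly_Mapping.lookup q d = 0" if "d \<in> monomials n" "\<not> lt a d" "\<not> lt d a" for d
        using that f(2) by (auto simp: lookup_lead_part in_keys_iff)
      then show ?thesis
        using JD(2) by (auto simp: C_def intro!: exI[of _ 0])
    qed
    then show "q \<in> Q"
      using f lead_part_in_polys[OF JD(1)[OF f(1)]] by (simp add: Q_def)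
  qed
  ultimately have "p \<in> Q"
    using p unfolding genideal_def by blast
  with a show ?thesis
    unfolding Q_def C_def by blast
qed

text \<open>The leading monomial \<open>m\<close> is maximal in \<open>h\<close> already for
  \<open>lt\<close>, so \<open>h\<close> and its leading part agree on the class of
  \<open>m\<close>. Take \<open>g\<close> in \<open>J\<close> with the same component there and
  nothing above it: any other monomial of \<open>g\<close> is either \<open>lt\<close>-below
  \<open>m\<close> or occurs in \<open>h\<close>.\<close>

lemma ex_same_leading_mon:
  fixes J :: "'k::field mpol set"
  assumes J: "ideal J (poly_ring n)" and h: "h \<in> polys n" "lead_part lt h \<in> Idl\<^bsub>poly_ring n\<^esub> (lead_part lt ` J)"
    and m: "leading_mon lt h m"
  shows "\<exists>g\<in>J. leading_mon lt g m"
proof -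
  have mh: "m \<in> Poly_Mapping.keys h" "m \<in> monomials n" "Poly_Mapping.keys h \<subseteq> monomials n"
    using m h(1) by (auto simp: leading_mon_def polys_def)
  have max: "\<not> lt m b" if "b \<in> Poly_Mapping.keys h" for b
    using m that mh(2) subsetD[OF mh(3) that] lt_irrefl[OF lt, of m] lt_trans[OF lt, of m b m]
    by (cases "b = m") (auto simp: leading_mon_def tie_break_def)
  obtain g where g: "g \<in> J" "\<And>b. b \<in> Poly_Mapping.keys g \<Longrightarrow> \<not> lt m b"
    "\<And>b. b \<in> monomials n \<Longrightarrow> \<not> lt m b \<Longrightarrow> \<not> lt b m \<Longrightarrow>
      Poly_Mapping.lookup g b = Poly_Mapping.lookup (lead_part lt h) b"
    using leading_ideal_components[OF J h(2) mh(2)] by blast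
  have gp: "Poly_Mapping.keys g \<subseteq> monomials n"
    using ideal_poly_ringD(1)[OF J g(1)] by (simp add: polys_def)
  have "Poly_Mapping.lookup g m = Poly_Mapping.lookup h m"
    using g(3)[of m] mh max lt_irrefl[OF lt, of m] by (auto simp: lookup_lead_part)
  moreover have "tie_break lt b m" if b: "b \<in> Poly_Mapping.keys g" "b \<noteq> m" for b
  proof (cases "lt b m")
    case False
    then have "Poly_Mapping.lookup (lead_part lt h) b \<noteq> 0"
      using g(2,3)[of b] b gp by (auto simp: in_keys_iff)
    then have "b \<in> Poly_Mapping.keys h"
      by (auto simp: lookup_lead_part in_keys_iff split: if_splits)
    with b m show ?thesis by (simp add: leading_mon_def)
  qed (simp add: tie_break_def)
  ultimately show ?thesis
    using g(1) mh(1) unfolding leading_mon_def by (metis in_keys_iff)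
qed

section \<open>Reduction steps and Mora's argument\<close>

lemma leading_mon_cancel:
  fixes h g :: "'k::field mpol"
  assumes "h \<in> polys n" "g \<in> polys n" "a \<in> monomials n"
    and h: "leading_mon lt h (a + m)" and g: "leading_mon lt g m"
  obtains c where
    "\<And>b. b \<in> Poly_Mapping.keys (h - Poly_Mapping.single a c * g) \<Longrightarrow> tie_break lt b (a + m)"
proof
  define c where "c = Poly_Mapping.lookup h (a + m) / Poly_Mapping.lookup g m"
  fix b assume b: "b \<in> Poly_Mapping.keys (h - Poly_Mapping.single a c * g)"
  have "Poly_Mapping.lookup g m \<noteq> 0"
    using g by (simp add: leading_mon_def in_keys_iff)
  then have "Poly_Mapping.lookup (h - Poly_Mapping.single a c * g) (a + m) = 0"
    by (simp add: lookup_minus lookup_single_mult c_def)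
  with b have ne: "b \<noteq> a + m"
    by (auto simp: in_keys_iff)
  show "tie_break lt b (a + m)"
  proof (cases "b \<in> Poly_Mapping.keys h")
    case True
    with h ne show ?thesis by (simp add: leading_mon_def)
  next
    case False
    with b have "b \<in> Poly_Mapping.keys (Poly_Mapping.single a c * g)"
      by (simp add: in_keys_iff lookup_minus)
    then obtain x where x: "b = a + x" "x \<in> Poly_Mapping.keys g"
      by (rule keys_single_mult)
    have "x \<in> monomials n" "m \<in> monomials n" "tie_break lt x m"
      using x ne g assms(2) by (auto simp: leading_mon_def polys_def)
    with x show ?thesis
      using tie_break_add_iff[of x m a] assms(3) by (simp add: add.commute)
  qed
qed

lemma ex_unit_mult_mem:
  fixes I J :: "'k::field mpol set"
  assumes I: "ideal I (poly_ring n)" and J: "ideal J (poly_ring n)" and "J \<subseteq> I" and "f \<in> I"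
    and lead: "\<And>h m. h \<in> I \<Longrightarrow> leading_mon lt h m \<Longrightarrow> \<exists>g\<in>J. leading_mon lt g m"
  shows "\<exists>u\<in>lead_one n lt. u * f \<in> J"
proof (rule ccontr)
  assume none: "\<not> ?thesis"
  note ID = ideal_poly_ringD[OF I] and JD = ideal_poly_ringD[OF J]
  define H where "H = {u * f - j | u j. u \<in> lead_one n lt \<and> j \<in> J}"
  have "H \<subseteq> I"
    using ID \<open>J \<subseteq> I\<close> \<open>f \<in> I\<close> by (auto simp: H_def lead_one_def)
  then have Hp: "H \<subseteq> polys n" and JHp: "J \<union> H \<subseteq> polys n"
    using ID(1) JD(1) by auto
  have H0: "0 \<notin> H"
    using none by (auto simp: H_def)
  have Hf: "f \<in> H"
    unfolding H_def using lead_one_1[OF lt] JD(2) by force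
  have mon: "m \<in> monomials n" if "leading_mon lt g m" "g \<in> J \<union> H" for g m
    using that JHp by (auto simp: leading_mon_def polys_def)

  \<comment> \<open>A multiple of a reducer from \<open>J\<close> is absorbed into \<open>j\<close>.
    A reducer from \<open>H\<close> also changes \<open>u\<close>, which stays in
    \<open>lead_one n lt\<close> because the multiplier \<open>a\<close> is then below 1. The last
    clause serves to control total degrees.\<close>
  have reduce: "\<exists>h'\<in>H. \<exists>m'. leading_mon lt h' m' \<and> tie_break lt m' (a + m) \<and>
      (\<forall>b\<in>Poly_Mapping.keys h'. b \<in> Poly_Mapping.keys h \<or> (\<exists>d\<in>Poly_Mapping.keys g. b = a + d))"
    if h: "h \<in> H" "leading_mon lt h (a + m)" and a: "a \<in> monomials n"
      and g: "g \<in> J \<union> H" "leading_mon lt g m"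
      and gJ: "g \<in> J \<or> tie_break lt (a + m) m" for h g a m
  proof -
    obtain c where c: "\<And>b. b \<in> Poly_Mapping.keys (h - Poly_Mapping.single a c * g) \<Longrightarrow> tie_break lt b (a + m)"
      using leading_mon_cancel[OF _ _ a h(2) g(2)] h(1) g(1) Hp JHp by blast
    let ?s = "Poly_Mapping.single a c"
    have s: "?s \<in> polys n" using a by (rule single_in_polys)
    obtain u j where u: "u \<in> lead_one n lt" "j \<in> J" "h = u * f - j"
      using h(1) by (auto simp: H_def)
    have "h - ?s * g \<in> H"
    proof (cases "g \<in> J")
      case True
      have "h - ?s * g = u * f - (j + ?s * g)" by (simp add: u)
      moreover have "j + ?s * g \<in> J" using True JD(3,4) s u by blast
      ultimately show ?thesis using u(1) unfolding H_def by blast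
    next
      case False
      with g obtain v i where v: "v \<in> lead_one n lt" "i \<in> J" "g = v * f - i"
        by (auto simp: H_def)
      have "tie_break lt (a + m) (0 + m)" using False gJ by simp
      then have "lt a 0"
        using tie_break_add_iff[OF a _ mon[OF g(2,1)], of 0] tie_break_0 by simp
      then have "u - ?s * v \<in> lead_one n lt"
        using lead_one_perturb u v a by blast
      moreover have "h - ?s * g = (u - ?s * v) * f - (j - ?s * i)"
        by (simp add: u v algebra_simps)
      moreover have "j - ?s * i \<in> J" using JD(4,5) s u v by blast
      ultimately show ?thesis unfolding H_def by blast
    qed
    moreover from this obtain m' where m': "leading_mon lt (h - ?s * g) m'"
      using ex_leading_mon Hp H0 by (metis subsetD)
    moreover have "tie_break lt m' (a + m)"
      using c m' by (auto simp: leading_mon_def)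
    moreover have "b \<in> Poly_Mapping.keys h \<or> (\<exists>d\<in>Poly_Mapping.keys g. b = a + d)"
      if "b \<in> Poly_Mapping.keys (h - ?s * g)" for b
    proof (cases "b \<in> Poly_Mapping.keys h")
      case False
      with that have "b \<in> Poly_Mapping.keys (?s * g)"
        by (simp add: in_keys_iff lookup_minus)
      then show ?thesis by (auto elim: keys_single_mult)
    qed simp
    ultimately show ?thesis by blast
  qed

  \<comment> \<open>\<open>E g m d\<close>: the ecart of \<open>g\<close>, the excess of its total degree over that of its leading
    monomial \<open>m\<close>, is at most \<open>d\<close>.\<close>
  define E where "E g m d \<longleftrightarrow> leading_mon lt g m \<and> (\<forall>b\<in>Poly_Mapping.keys g. mdeg n b \<le> mdeg n m + d)"
    for g :: "'k mpol" and m d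
  define A where "A = {(m, d). \<exists>g\<in>J \<union> H. E g m d}"
  \<comment> \<open>The ecart bound is coordinate \<open>n\<close>, after the \<open>n\<close>
    exponents. Being dominated in all coordinates thus means divisibility together with no larger
    ecart.\<close>
  let ?v = "\<lambda>(m, d) i. if i < n then Poly_Mapping.lookup m i else d"
  obtain B where B: "B \<subseteq> A" "finite B" "\<And>x. x \<in> A \<Longrightarrow> \<exists>y\<in>B. \<forall>i\<in>{..n}. ?v y i \<le> ?v x i"
    using dickson[of "{..n}" A ?v] by blast
  have basis: "\<exists>m' d' a. (m', d') \<in> B \<and> d' \<le> d \<and> a \<in> monomials n \<and> m = a + m'"
    if md: "(m, d) \<in> A" for m d
  proof -
    obtain m' d' where y: "(m', d') \<in> B" "\<forall>i\<in>{..n}. ?v (m', d') i \<le> ?v (m, d) i"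
      using B(3)[OF md] by auto
    have "d' \<le> d" using y(2) by (auto dest: bspec[of _ _ n])
    moreover have "Poly_Mapping.lookup m' i \<le> Poly_Mapping.lookup m i" if "i < n" for i
      using y(2) that by (auto dest: bspec[of _ _ i])
    moreover have "m \<in> monomials n" "m' \<in> monomials n"
      using md y(1) B(1) mon by (auto simp: A_def E_def)
    ultimately show ?thesis
      using y(1) mon_dvdI[of m n m'] by blast
  qed

  obtain m\<^sub>f where mf: "leading_mon lt f m\<^sub>f"
    using ex_leading_mon[of f] Hf Hp H0 by blast
  \<comment> \<open>These are the leading monomials of the basis elements realized in
    \<open>H\<close>; \<open>m\<^sub>f\<close> is inserted so that the set has a least
    element.\<close>
  let ?M = "insert m\<^sub>f (fst ` {(m, d) \<in> B. \<exists>g\<in>H. E g m d})"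
  have M: "finite ?M" "\<And>m. m \<in> ?M \<Longrightarrow> \<exists>g\<in>H. leading_mon lt g m"
    using mf Hf by (auto intro: finite_subset[OF _ B(2)] simp: E_def)
  then have Mm: "?M \<subseteq> monomials n" using mon by blast
  obtain m\<^sub>0 where m0: "m\<^sub>0 \<in> ?M" "\<And>x. x \<in> ?M \<Longrightarrow> x = m\<^sub>0 \<or> tie_break lt m\<^sub>0 x"
    using ex_tie_break_min[OF M(1) _ Mm] by blast
  obtain h\<^sub>0 where h0: "h\<^sub>0 \<in> H" "leading_mon lt h\<^sub>0 m\<^sub>0"
    using M(2) m0(1) by blast
  \<comment> \<open>One reduction of \<open>h\<^sub>0\<close> by an element of \<open>J\<close> with
    the same leading monomial, with multiplier 1, brings the leading monomial strictly below all of
    \<open>?M\<close>.\<close>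
  obtain g\<^sub>0 where g0: "g\<^sub>0 \<in> J" "leading_mon lt g\<^sub>0 m\<^sub>0"
    using lead h0 \<open>H \<subseteq> I\<close> by blast
  obtain h\<^sub>1 m\<^sub>1 where h1: "h\<^sub>1 \<in> H" "leading_mon lt h\<^sub>1 m\<^sub>1" "tie_break lt m\<^sub>1 m\<^sub>0"
    using reduce[of h\<^sub>0 0 m\<^sub>0 g\<^sub>0] h0 g0 by auto

  define D where "D = Max (mdeg n ` Poly_Mapping.keys h\<^sub>1)"
  \<comment> \<open>\<open>Y\<close> is finite by the degree bound. The contradiction will be a
    further reduction of an element whose leading monomial is least in \<open>Y\<close>, with a
    result that still satisfies all conditions.\<close>
  define Y where "Y = {m. \<exists>h\<in>H. leading_mon lt h m \<and> (\<forall>x\<in>?M. tie_break lt m x) \<and>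
    (\<forall>b\<in>Poly_Mapping.keys h. mdeg n b \<le> D)}"
  have "Y \<subseteq> {a \<in> monomials n. mdeg n a \<le> D}"
    using mon by (auto simp: Y_def leading_mon_def)
  then have Y: "finite Y" "Y \<subseteq> monomials n"
    using finite_bounded_mdeg finite_subset by blast+
  have "tie_break lt m\<^sub>1 x" if "x \<in> ?M" for x
    using m0(2)[OF that] h1(3) tie_break_trans[of m\<^sub>1 m\<^sub>0 x] mon[OF h1(2)] h1(1) m0(1) that Mm
    by blast
  then have "m\<^sub>1 \<in> Y"
    using h1(1,2) unfolding Y_def D_def by (blast intro: Max_ge finite_imageI finite_keys)
  then obtain m where m: "m \<in> Y" "\<And>x. x \<in> Y \<Longrightarrow> x = m \<or> tie_break lt m x"
    using ex_tie_break_min[OF Y(1) _ Y(2)] by blast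
  then obtain h where h: "h \<in> H" "leading_mon lt h m" "\<And>x. x \<in> ?M \<Longrightarrow> tie_break lt m x"
    "\<And>b. b \<in> Poly_Mapping.keys h \<Longrightarrow> mdeg n b \<le> D"
    unfolding Y_def by blast
  have mD: "mdeg n m \<le> D" using h(2,4) by (simp add: leading_mon_def)
  \<comment> \<open>The degree bound on \<open>h\<close> says that its ecart is at most
    \<open>D - mdeg n m\<close>; by \<open>mD\<close> this difference is not truncated.\<close>
  with h have "(m, D - mdeg n m) \<in> A"
    by (auto simp: A_def E_def intro!: bexI[of _ h])
  then obtain m' d a where d: "(m', d) \<in> B" "d \<le> D - mdeg n m" "a \<in> monomials n" "m = a + m'"
    using basis by blast
  \<comment> \<open>If the basis pair is realized in \<open>H\<close>, then \<open>m'\<close>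
    belongs to \<open>?M\<close>, so \<open>m\<close> lies below it; otherwise it is realized in
    \<open>J\<close>. Both cases allow a reduction.\<close>
  have "\<exists>g\<in>J \<union> H. E g m' d \<and> (g \<in> J \<or> tie_break lt (a + m') m')"
  proof (cases "\<exists>g\<in>H. E g m' d")
    case True
    then have "m' \<in> ?M" using d(1) by force
    then show ?thesis using True h(3) d(4) by blast
  next
    case False
    with d(1) B(1) show ?thesis by (auto simp: A_def)
  qed
  then obtain g where g: "g \<in> J \<union> H" "E g m' d" "g \<in> J \<or> tie_break lt (a + m') m'" by blast
  then obtain h' m'' where h': "h' \<in> H" "leading_mon lt h' m''" "tie_break lt m'' m"
    "\<And>b. b \<in> Poly_Mapping.keys h' \<Longrightarrow> b \<in> Poly_Mapping.keys h \<or> (\<exists>x\<in>Poly_Mapping.keys g. b = a + x)"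
    using reduce[of h a m' g] h d unfolding E_def by blast
  have mm: "m \<in> monomials n" "m'' \<in> monomials n"
    using mon h h' by blast+
  have "mdeg n b \<le> D" if b: "b \<in> Poly_Mapping.keys h'" for b
  proof -
    \<comment> \<open>The degree of \<open>x\<close> is at most \<open>mdeg n m' + d\<close>, so
      that of \<open>a + x\<close> is at most \<open>mdeg n m + d\<close>, which the choice of
      \<open>d\<close> keeps within \<open>D\<close>.\<close>
    have "mdeg n (a + x) \<le> D" if "x \<in> Poly_Mapping.keys g" for x
      using g(2) that d(2,4) mD by (auto simp: E_def mdeg_add)
    then show ?thesis using h'(4)[OF b] h(4) by blast
  qed
  moreover have "tie_break lt m'' x" if "x \<in> ?M" for x
    using tie_break_trans[of m'' m x] h(3)[OF that] h'(3) that Mm mm by blast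
  ultimately have "m'' \<in> Y"
    using h'(1,2) unfolding Y_def by blast
  from m(2)[OF this] show False
    using h'(3) mm tie_break_irrefl[of m] tie_break_trans[of m m'' m] by blast
qed

section \<open>Passing between ideals of the localization and their numerators\<close>

lemma Fract_polys_in_loc_carrier: "p \<in> polys n \<Longrightarrow> Fract p 1 \<in> loc_carrier n lt"
  using lead_one_1[OF lt] unfolding loc_carrier_def by blast

lemma ideal_numerators:
  fixes Y :: "'k::field mpol fract set"
  assumes "ideal Y (loc_ring n lt)"
  shows "ideal (numerators n Y) (poly_ring n)"
proof -
  interpret Y: ideal Y "loc_ring n lt :: 'k mpol fract ring" by fact
  note add = ideal.axioms(1)[OF assms]
  have "Fract (p + q) 1 \<in> Y" if "Fract p 1 \<in> Y" "Fract q 1 \<in> Y" for p q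
    using additive_subgroup.a_closed[OF add that] by simp
  moreover have "Fract (r * p) 1 \<in> Y" if "r \<in> polys n" "Fract p 1 \<in> Y" for r p
    using Y.I_l_closed[of "Fract p 1" "Fract r 1"] that Fract_polys_in_loc_carrier[of r] by simp
  moreover have "Fract 0 1 \<in> Y"
    using additive_subgroup.zero_closed[OF add] by (simp add: Zero_fract_def)
  ultimately show ?thesis
    unfolding ideal_poly_ring_iff by (auto simp: numerators_def polys_add polys_mult)
qed

text \<open>Elements of \<open>lead_one n lt\<close> are invertible in the localization, with
  inverse \<open>Fract 1 u\<close>.\<close>

lemma unit_mult_mem_iff:
  fixes Y :: "'k::field mpol fract set"
  assumes "ideal Y (loc_ring n lt)" "u \<in> lead_one n lt" "x \<in> loc_carrier n lt"
  shows "Fract u 1 * x \<in> Y \<longleftrightarrow> x \<in> Y"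
proof -
  interpret Y: ideal Y "loc_ring n lt :: 'k mpol fract ring" by fact
  have u: "u \<in> polys n" "u \<noteq> 0"
    using assms(2) zero_notin_lead_one by (auto simp: lead_one_def)
  have "Fract 1 u \<in> loc_carrier n lt"
    using assms(2) polys_1 unfolding loc_carrier_def by blast
  then have "Fract 1 u * (Fract u 1 * x) \<in> Y" if "Fract u 1 * x \<in> Y"
    using Y.I_l_closed[OF that] by simp
  moreover have "Fract 1 u * (Fract u 1 * x) = x"
  proof -
    have "Fract 1 u * Fract u 1 = 1"
      using u by (simp add: One_fract_def eq_fract)
    then show ?thesis
      by (simp only: mult.assoc[symmetric] mult_1)
  qed
  moreover have "Fract u 1 * x \<in> Y" if "x \<in> Y"
    using Y.I_l_closed[OF that] Fract_polys_in_loc_carrier[OF u(1)] by simp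
  ultimately show ?thesis by auto
qed

text \<open>A numerator \<open>p\<close> of \<open>x\<close> in \<open>Y\<close> again lies in
  \<open>Y\<close>, being a multiple of \<open>x\<close>; conversely a polynomial is its own
  numerator, with \<open>u = 1\<close>. So the leading ideal of \<open>Y\<close> can be computed
  from polynomials alone.\<close>

lemma loc_lead_part_image:
  fixes Y :: "'k::field mpol fract set"
  assumes Y: "ideal Y (loc_ring n lt)"
  shows "loc_lead_part n lt ` Y = lead_part lt ` numerators n Y"
proof (intro equalityI subsetI)
  interpret Y: ideal Y "loc_ring n lt :: 'k mpol fract ring" by fact
  fix q
  show "q \<in> lead_part lt ` numerators n Y" if q: "q \<in> loc_lead_part n lt ` Y"
  proof -
    obtain x where x: "x \<in> Y" "q = loc_lead_part n lt x" using q by blast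
    have xc: "x \<in> loc_carrier n lt" using Y.Icarr[OF x(1)] by simp
    obtain p u where p: "p \<in> polys n" "u \<in> lead_one n lt" "Fract p 1 = Fract u 1 * x"
      using ex_numerator[OF lt xc] by blast
    then have "p \<in> numerators n Y"
      using unit_mult_mem_iff[OF Y p(2) xc] x(1) by (simp add: numerators_def)
    with x(2) loc_lead_part_eq[OF lt p] show ?thesis by blast
  qed
  show "q \<in> loc_lead_part n lt ` Y" if q: "q \<in> lead_part lt ` numerators n Y"
  proof -
    obtain p where p: "p \<in> polys n" "Fract p 1 \<in> Y" "q = lead_part lt p"
      using q by (auto simp: numerators_def)
    have "loc_lead_part n lt (Fract p 1) = q"
      using loc_lead_part_eq[OF lt p(1) lead_one_1[OF lt], of "Fract p 1"] p(3) by simp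
    with p(2) show ?thesis by blast
  qed
qed

end

theorem theorem2p4:
  fixes n :: nat
    and lt :: "mon \<Rightarrow> mon \<Rightarrow> bool"
    and I J :: "'k::field mpol fract set"
  assumes "monomial_preorder n lt"
    and "ideal I (loc_ring n lt)"
    and "ideal J (loc_ring n lt)"
    and "J \<subseteq> I"
    and "leading_ideal n lt J = leading_ideal n lt I"
  shows "J = I"
proof
  note lt = assms(1) and I = assms(2) and J = assms(3)
  let ?N = "numerators n :: 'k mpol fract set \<Rightarrow> 'k mpol set"
  have NI: "ideal (?N I) (poly_ring n)" and NJ: "ideal (?N J) (poly_ring n)"
    using ideal_numerators[OF lt] I J by blast+
  interpret P: cring "poly_ring n :: 'k mpol ring" by (rule poly_ring_cring)
  have "\<exists>g\<in>?N J. leading_mon lt g m" if h: "h \<in> ?N I" "leading_mon lt h m" for h m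
  proof -
    have "lead_part lt ` ?N I \<subseteq> carrier (poly_ring n)"
      by (auto simp: numerators_def lead_part_in_polys)
    then have "lead_part lt h \<in> Idl\<^bsub>poly_ring n\<^esub> (lead_part lt ` ?N I)"
      using P.genideal_self h(1) by blast
    also have "\<dots> = Idl\<^bsub>poly_ring n\<^esub> (lead_part lt ` ?N J)"
      using assms(5) by (simp add: leading_ideal_def loc_lead_part_image[OF lt] I J)
    finally show ?thesis
      using ex_same_leading_mon[OF lt NJ _ _ h(2)] h(1) by (auto simp: numerators_def)
  qed
  then have unit: "\<exists>u\<in>lead_one n lt. u * f \<in> ?N J" if "f \<in> ?N I" for f
    using ex_unit_mult_mem[OF lt NI NJ _ that] \<open>J \<subseteq> I\<close> by (auto simp: numerators_def)
  interpret I: ideal I "loc_ring n lt :: 'k mpol fract ring" by fact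
  show "I \<subseteq> J"
  proof
    fix x assume x: "x \<in> I"
    have xc: "x \<in> loc_carrier n lt" using I.Icarr[OF x] by simp
    obtain p u where p: "p \<in> polys n" "u \<in> lead_one n lt" "Fract p 1 = Fract u 1 * x"
      using ex_numerator[OF lt xc] by blast
    then have "p \<in> ?N I"
      using unit_mult_mem_iff[OF lt I p(2) xc] x by (simp add: numerators_def)
    \<comment> \<open>A multiple of \<open>p\<close> by some \<open>v\<close> lies in
      \<open>J\<close>; cancelling first \<open>v\<close> and then \<open>u\<close> puts
      \<open>x\<close> itself into \<open>J\<close>.\<close>
    then obtain v where v: "v \<in> lead_one n lt" "Fract v 1 * Fract p 1 \<in> J"
      using unit by (auto simp: numerators_def)
    then have "Fract u 1 * x \<in> J"
      using unit_mult_mem_iff[OF lt J v(1) Fract_polys_in_loc_carrier[OF lt p(1)]] p(3) by simp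
    then show "x \<in> J"
      using unit_mult_mem_iff[OF lt J p(2) xc] by simp
  qed
qed (fact \<open>J \<subseteq> I\<close>)

end
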